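(* Let $C$ be a curve in a Myller configuration $M(C,\bar\xi,\pi)$ with alternative frame $R_A=\{P(s);\bar\xi_2,\bar Y,\bar D\}$ and (nowhere) non-zero alternative curvatures $p,q$. Then $C$ is a slant helix (equivalently, a Darboux helix) if and only if $\bar Y$ satisfies the differential equation $$\bar Y''+q\left(\frac1q\right)'\bar Y'+(p^2+q^2)\bar Y=0.$$
   Context: All data are smooth. Let $C$ be a curve in Euclidean space $E^3$ with arclength parameter $s\in I$ ($I$ an interval) and position vector $\bar r(s)$, let $\bar\xi(s)$ be a unit vector field along $C$ (a versor field $(C,\bar\xi)$), and let $\pi(s)$ be a plane field along $C$ with $\bar\xi(s)\in\pi(s)$. The pair $((C,\bar\xi),(C,\pi))$ is called a Myller configuration $M=M(C,\bar\xi,\pi)$. Put $\bar\xi_1=\bar\xi$, $K_1=\|d\bar\xi/ds\|>0$ (curvature), define $\bar\xi_2$ by $\bar\xi_1'=K_1\bar\xi_2$, and $\bar\xi_3=\bar\xi_1\times\bar\xi_2$. Then $\{\bar\xi_1,\bar\xi_2,\bar\xi_3\}$ is a positively oriented orthonormal frame, the Frenet-type frame $R_F$, and $$\bar\xi_1'=K_1\bar\xi_2,\quad \bar\xi_2'=-K_1\bar\xi_1+K_2\bar\xi_3,\quad \bar\xi_3'=-K_2\bar\xi_2,$$ which defines the torsion $K_2$. A prime denotes $d/ds$. The alternative frame (AF-frame) is the orthonormal frame $R_A=\{P(s);\bar\xi_2,\bar Y,\bar D\}$ with $\bar Y=\bar\xi_2'/\|\bar\xi_2'\|$ and $\bar D=\bar\xi_2\times\bar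 Y=\frac{K_2}{\sqrt{K_1^2+K_2^2}}\bar\xi_1+\frac{K_1}{\sqrt{K_1^2+K_2^2}}\bar\xi_3$. It satisfies $\bar\xi_2'=p\bar Y$, $\bar Y'=-p\bar\xi_2+q\bar D$, $\bar D'=-q\bar Y$, where the alternative curvatures are $p=\sqrt{K_1^2+K_2^2}$ and $q=\frac{K_1^2}{K_1^2+K_2^2}\left(\frac{K_2}{K_1}\right)'$. The curve $C$ is called a slant helix (or $\bar\xi_2$-helix) in $M$ if $\bar\xi_2$ makes a constant angle with a fixed unit vector, and a Darboux helix in $M$ if $\bar D$ makes a constant angle with a constant unit vector. *)

theory Defs
  imports "HOL-Analysis.Analysis"
begin

(* Differentiation along the parameter interval: one-sided at an endpoint contained in I. *)
definition deriv_on :: "real set \<Rightarrow> (real \<Rightarrow> 'a::real_normed_vector) \<Rightarrow> real \<Rightarrow> 'a" where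
  "deriv_on I f s = vector_derivative f (at s within I)"

definition smooth_on :: "real set \<Rightarrow> (real \<Rightarrow> 'a::real_normed_vector) \<Rightarrow> bool" where
  "smooth_on I f \<longleftrightarrow> (\<forall>n. ((deriv_on I ^^ n) f) differentiable_on I)"

definition vec_angle :: "'a::real_inner \<Rightarrow> 'a \<Rightarrow> real" where
  "vec_angle u v = arccos ((u \<bullet> v) / (norm u * norm v))"

(* Planes are represented by their direction, a two-dimensional linear subspace.
   Over an interval every smooth plane field has a global smooth basis, so asking for
   one is no restriction. *)
definition smooth_plane_field_on :: "real set \<Rightarrow> (real \<Rightarrow> (real^3) set) \<Rightarrow> bool" where
  "smooth_plane_field_on I \<pi> \<longleftrightarrow>
    (\<exists>a b. smooth_on I a \<and> smooth_on I b \<and>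
      (\<forall>s\<in>I. a s \<noteq> b s \<and> independent {a s, b s} \<and> \<pi> s = span {a s, b s}))"

definition \<xi>1 :: "(real \<Rightarrow> real^3) \<Rightarrow> real \<Rightarrow> real^3" where
  "\<xi>1 \<xi> = \<xi>"

definition K1 :: "real set \<Rightarrow> (real \<Rightarrow> real^3) \<Rightarrow> real \<Rightarrow> real" where
  "K1 I \<xi> s = norm (deriv_on I \<xi> s)"

definition \<xi>2 :: "real set \<Rightarrow> (real \<Rightarrow> real^3) \<Rightarrow> real \<Rightarrow> real^3" where
  "\<xi>2 I \<xi> s = (1 / K1 I \<xi> s) *\<^sub>R deriv_on I (\<xi>1 \<xi>) s"

definition \<xi>3 :: "real set \<Rightarrow> (real \<Rightarrow> real^3) \<Rightarrow> real \<Rightarrow> real^3" where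
  "\<xi>3 I \<xi> s = cross3 (\<xi>1 \<xi> s) (\<xi>2 I \<xi> s)"

(* The coefficient of \<xi>3 in \<xi>2' = - K1 \<xi>1 + K2 \<xi>3, the frame being orthonormal. *)
definition K2 :: "real set \<Rightarrow> (real \<Rightarrow> real^3) \<Rightarrow> real \<Rightarrow> real" where
  "K2 I \<xi> s = deriv_on I (\<xi>2 I \<xi>) s \<bullet> \<xi>3 I \<xi> s"

definition myller_configuration ::
  "real set \<Rightarrow> (real \<Rightarrow> real^3) \<Rightarrow> (real \<Rightarrow> real^3) \<Rightarrow> (real \<Rightarrow> (real^3) set) \<Rightarrow> bool" where
  "myller_configuration I r \<xi> \<pi> \<longleftrightarrow>
     is_interval I \<and> interior I \<noteq> {} \<and>
     smooth_on I r \<and> (\<forall>s\<in>I. norm (deriv_on I r s) = 1) \<and>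
     smooth_on I \<xi> \<and> (\<forall>s\<in>I. norm (\<xi> s) = 1) \<and>
     smooth_plane_field_on I \<pi> \<and> (\<forall>s\<in>I. \<xi> s \<in> \<pi> s) \<and>
     (\<forall>s\<in>I. K1 I \<xi> s > 0)"

definition AF_Y :: "real set \<Rightarrow> (real \<Rightarrow> real^3) \<Rightarrow> real \<Rightarrow> real^3" where
  "AF_Y I \<xi> s = (1 / norm (deriv_on I (\<xi>2 I \<xi>) s)) *\<^sub>R deriv_on I (\<xi>2 I \<xi>) s"

definition AF_D :: "real set \<Rightarrow> (real \<Rightarrow> real^3) \<Rightarrow> real \<Rightarrow> real^3" where
  "AF_D I \<xi> s = cross3 (\<xi>2 I \<xi> s) (AF_Y I \<xi> s)"

definition AF_p :: "real set \<Rightarrow> (real \<Rightarrow> real^3) \<Rightarrow> real \<Rightarrow> real" where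
  "AF_p I \<xi> s = sqrt ((K1 I \<xi> s)\<^sup>2 + (K2 I \<xi> s)\<^sup>2)"

definition AF_q :: "real set \<Rightarrow> (real \<Rightarrow> real^3) \<Rightarrow> real \<Rightarrow> real" where
  "AF_q I \<xi> s = (K1 I \<xi> s)\<^sup>2 / ((K1 I \<xi> s)\<^sup>2 + (K2 I \<xi> s)\<^sup>2)
     * deriv_on I (\<lambda>t. K2 I \<xi> t / K1 I \<xi> t) s"

definition constant_angle_on :: "real set \<Rightarrow> (real \<Rightarrow> real^3) \<Rightarrow> bool" where
  "constant_angle_on I V \<longleftrightarrow>
    (\<exists>u. norm u = 1 \<and> (\<lambda>s. vec_angle (V s) u) constant_on I)"

definition slant_helix :: "real set \<Rightarrow> (real \<Rightarrow> real^3) \<Rightarrow> bool" where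
  "slant_helix I \<xi> \<longleftrightarrow> constant_angle_on I (\<xi>2 I \<xi>)"

definition darboux_helix :: "real set \<Rightarrow> (real \<Rightarrow> real^3) \<Rightarrow> bool" where
  "darboux_helix I \<xi> \<longleftrightarrow> constant_angle_on I (AF_D I \<xi>)"

end

theory Submission
  imports Defs
begin

text \<open>
  Write \<open>T\<close> for \<open>\<xi>\<^sub>2\<close>. All three conditions say that the ratio \<open>p / q\<close> is constant on
  the interval, because the orthonormal frame satisfies \<open>T' = p Y\<close>, \<open>Y' = - p T + q D\<close>,
  \<open>D' = - q Y\<close>.

  If \<open>T\<close> makes a constant angle with the unit vector \<open>u\<close>, then \<open>T \<bullet> u = c\<close> is constant.
  Differentiating once gives \<open>Y \<bullet> u = 0\<close>, since \<open>p\<close> has no zero, and differentiating again gives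
  \<open>p c = q (D \<bullet> u)\<close>. Since \<open>D' = - q Y\<close>, the factor \<open>D \<bullet> u\<close> is constant as well; and \<open>c = 0\<close> would
  force \<open>u = 0\<close>, so \<open>p / q\<close> is constant. Conversely, if \<open>p = k q\<close>, then \<open>T + k D\<close> has derivative
  zero, and this fixed vector is the axis of the helix (\<open>T_angle_constant_iff\<close>). The system is
  invariant under exchanging \<open>T\<close> with \<open>D\<close> and \<open>(p, q)\<close> with \<open>(- q, - p)\<close>, which replaces \<open>p / q\<close>
  by its reciprocal; so the same argument characterises Darboux helices
  (\<open>D_angle_constant_iff\<close>). Finally, substituting the frame equations shows that the differential
  operator of the theorem maps \<open>Y\<close> to \<open>- q (p / q)' T\<close> (\<open>Y_operator\<close>), which vanishes exactly
  when \<open>(p / q)' = 0\<close>.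

  It remains to see that the frame of a Myller configuration satisfies these equations with smooth
  \<open>p\<close> and \<open>q\<close>. Smoothness of the derived quantities comes from a closure theory for smooth
  functions on a set without isolated points. The coefficient \<open>p\<close> is the norm of \<open>\<xi>\<^sub>2'\<close>
  by the Frenet equations; differentiating the orthonormality relations then leaves only one
  coefficient undetermined, \<open>D' \<bullet> Y = - q\<close>, which comes from writing \<open>D\<close> in
  terms of \<open>\<xi>\<^sub>1\<close> and \<open>\<xi>\<^sub>3\<close> (\<open>D_deriv_inner_Y\<close>).
\<close>

section \<open>Calculus along an interval\<close>

text \<open>
  Without isolated points the derivative relative to the set is unique, so that \<^const>\<open>deriv_on\<close>
  can be computed by exhibiting a derivative.
\<close>

locale perfect_set =
  fixes I :: "real set"
  assumes not_isolated: "s \<in> I \<Longrightarrow> at s within I \<noteq> bot"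
begin

lemma deriv_on_eq:
  assumes "(f has_vector_derivative f') (at s within I)" "s \<in> I"
  shows "deriv_on I f s = f'"
  unfolding deriv_on_def using assms not_isolated vector_derivative_within by blast

end

lemma deriv_on_cong:
  assumes "\<And>t. t \<in> I \<Longrightarrow> f t = g t" "s \<in> I"
  shows "deriv_on I f s = deriv_on I g s"
proof -
  have "(f has_vector_derivative d) (at s within I) \<longleftrightarrow>
      (g has_vector_derivative d) (at s within I)" for d
    using assms has_vector_derivative_transform[of s I f g d]
      has_vector_derivative_transform[of s I g f d] by metis
  then show ?thesis unfolding deriv_on_def vector_derivative_def by simp
qed

lemma has_vector_derivative_deriv_on:
  assumes "f differentiable_on I" "s \<in> I"
  shows "(f has_vector_derivative deriv_on I f s) (at s within I)"
  using assms unfolding differentiable_on_def deriv_on_def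
  by (simp add: vector_derivative_works)

text \<open>
  The derivative is taken off first, rather than last as in an iterated derivative: the product and
  power rules can then be applied inside an induction on the order.
\<close>

primrec diff_upto :: "nat \<Rightarrow> real set \<Rightarrow> (real \<Rightarrow> 'a::real_normed_vector) \<Rightarrow> bool" where
  "diff_upto 0 I f = True"
| "diff_upto (Suc n) I f = (f differentiable_on I \<and> diff_upto n I (deriv_on I f))"

lemma diff_upto_iff: "diff_upto n I f \<longleftrightarrow> (\<forall>m<n. ((deriv_on I ^^ m) f) differentiable_on I)"
proof (induction n arbitrary: f)
  case (Suc n)
  show ?case
    by (simp add: Suc All_less_Suc2 funpow_swap1)
qed simp

lemma smooth_on_iff: "smooth_on I f \<longleftrightarrow> (\<forall>n. diff_upto n I f)"
  unfolding smooth_on_def diff_upto_iff by blast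

lemma smooth_on_diff_upto_Suc: "smooth_on I f \<Longrightarrow> diff_upto (Suc n) I f"
  unfolding smooth_on_iff by blast

lemma smooth_on_deriv_on: "smooth_on I f \<Longrightarrow> smooth_on I (deriv_on I f)"
  using smooth_on_diff_upto_Suc[of I f] unfolding smooth_on_iff[of I "deriv_on I f"] by simp

lemma smooth_on_differentiable: "smooth_on I f \<Longrightarrow> f differentiable_on I"
  using smooth_on_diff_upto_Suc[of I f 0] by simp

lemma smooth_on_has_derivative:
  "smooth_on I f \<Longrightarrow> s \<in> I \<Longrightarrow> (f has_vector_derivative deriv_on I f s) (at s within I)"
  by (intro has_vector_derivative_deriv_on smooth_on_differentiable)

lemma diff_upto_cong:
  assumes "\<And>t. t \<in> I \<Longrightarrow> f t = g t" "diff_upto n I f"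
  shows "diff_upto n I g"
  using assms
proof (induction n arbitrary: f g)
  case (Suc n)
  have "g differentiable_on I"
    unfolding differentiable_on_def
  proof
    fix t assume t: "t \<in> I"
    have "(f has_vector_derivative deriv_on I f t) (at t within I)"
      using Suc.prems(2) t by (auto intro: has_vector_derivative_deriv_on)
    then have "(g has_vector_derivative deriv_on I f t) (at t within I)"
      using has_vector_derivative_transform[OF t, of g f] Suc.prems(1) by auto
    then show "g differentiable (at t within I)" by (rule differentiableI_vector)
  qed
  moreover have "diff_upto n I (deriv_on I g)"
    using Suc.IH[of "deriv_on I f" "deriv_on I g"] deriv_on_cong[of I f g] Suc.prems by auto
  ultimately show ?case by simp
qed simp

lemma diff_upto_Suc_D: "diff_upto (Suc n) I f \<Longrightarrow> diff_upto n I f"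
  unfolding diff_upto_iff by auto

lemma smooth_on_cong:
  assumes "smooth_on I f" "\<And>t. t \<in> I \<Longrightarrow> f t = g t"
  shows "smooth_on I g"
  using assms diff_upto_cong[of I f g] unfolding smooth_on_iff by blast

context perfect_set
begin

lemma diff_upto_SucI:
  assumes "\<And>s. s \<in> I \<Longrightarrow> (f has_vector_derivative f' s) (at s within I)"
    and "diff_upto n I f'"
  shows "diff_upto (Suc n) I f"
proof -
  have "f differentiable_on I"
    using assms(1) unfolding differentiable_on_def by (blast intro: differentiableI_vector)
  moreover have "diff_upto n I (deriv_on I f)"
    by (rule diff_upto_cong[OF _ assms(2)]) (rule deriv_on_eq[OF assms(1), symmetric])
  ultimately show ?thesis by simp
qed

lemma diff_upto_const: "diff_upto n I (\<lambda>_. c)"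
proof (induction n arbitrary: c)
  case (Suc n)
  show ?case
    by (rule diff_upto_SucI[OF has_vector_derivative_const]) (rule Suc.IH)
qed simp

lemma diff_upto_add:
  "diff_upto n I f \<Longrightarrow> diff_upto n I g \<Longrightarrow> diff_upto n I (\<lambda>s. f s + g s)"
proof (induction n arbitrary: f g)
  case (Suc n)
  then show ?case
    by (intro diff_upto_SucI[where f' = "\<lambda>s. deriv_on I f s + deriv_on I g s"])
      (auto intro!: has_vector_derivative_add has_vector_derivative_deriv_on)
qed simp

text \<open>
  The derivative of a product is a sum of two products, each with one factor of lower order and the
  other of the original order; the induction hypothesis applies after weakening the latter.
\<close>

lemma diff_upto_bilinear:
  assumes "bounded_bilinear m" "diff_upto n I f" "diff_upto n I g"
  shows "diff_upto n I (\<lambda>s. m (f s) (g s))"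
  using assms(2,3)
proof (induction n arbitrary: f g)
  case (Suc n)
  note low = Suc.prems[THEN diff_upto_Suc_D]
  show ?case
  proof (rule diff_upto_SucI)
    show "((\<lambda>s. m (f s) (g s)) has_vector_derivative
        m (f s) (deriv_on I g s) + m (deriv_on I f s) (g s)) (at s within I)"
      if "s \<in> I" for s
      using Suc.prems that
      by (auto intro!: bounded_bilinear.has_vector_derivative[OF assms(1)]
          has_vector_derivative_deriv_on)
    show "diff_upto n I (\<lambda>s. m (f s) (deriv_on I g s) + m (deriv_on I f s) (g s))"
      using Suc low by (intro diff_upto_add) auto
  qed
qed simp

lemma has_vector_derivative_powr:
  fixes f :: "real \<Rightarrow> real"
  assumes "(f has_vector_derivative f') (at s within I)" "f s > 0"
  shows "((\<lambda>t. f t powr a) has_vector_derivative (a * f') * f s powr (a - 1)) (at s within I)"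
  using assms unfolding has_real_derivative_iff_has_vector_derivative[symmetric]
  by (auto intro!: derivative_eq_intros simp: powr_diff field_simps)

text \<open>
  One statement for all real exponents serves for reciprocals and for square roots, and the family
  of powers is closed under differentiation up to a factor \<open>f'\<close>; hence the exponent varies in the
  induction.
\<close>

lemma diff_upto_powr:
  fixes f :: "real \<Rightarrow> real"
  assumes pos: "\<And>s. s \<in> I \<Longrightarrow> f s > 0" and "diff_upto n I f"
  shows "diff_upto n I (\<lambda>s. f s powr a)"
  using assms(2)
proof (induction n arbitrary: a)
  case (Suc n)
  show ?case
  proof (rule diff_upto_SucI)
    show "((\<lambda>t. f t powr a) has_vector_derivative (a * deriv_on I f s) * f s powr (a - 1))
        (at s within I)" if "s \<in> I" for s
      using Suc.prems that pos by (auto intro!: has_vector_derivative_powr has_vector_derivative_deriv_on)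
    show "diff_upto n I (\<lambda>s. (a * deriv_on I f s) * f s powr (a - 1))"
      using Suc.prems Suc.IH[OF diff_upto_Suc_D[OF Suc.prems]]
      by (intro diff_upto_bilinear[OF bounded_bilinear_mult] diff_upto_const) auto
  qed
qed simp

lemma smooth_on_const: "smooth_on I (\<lambda>_. c)"
  unfolding smooth_on_iff by (simp add: diff_upto_const)

lemma smooth_on_add: "smooth_on I f \<Longrightarrow> smooth_on I g \<Longrightarrow> smooth_on I (\<lambda>s. f s + g s)"
  unfolding smooth_on_iff by (simp add: diff_upto_add)

lemma smooth_on_bilinear:
  "bounded_bilinear m \<Longrightarrow> smooth_on I f \<Longrightarrow> smooth_on I g \<Longrightarrow> smooth_on I (\<lambda>s. m (f s) (g s))"
  unfolding smooth_on_iff by (simp add: diff_upto_bilinear)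

lemmas smooth_on_mult = smooth_on_bilinear[OF bounded_bilinear_mult]
lemmas smooth_on_scaleR = smooth_on_bilinear[OF bounded_bilinear_scaleR]
lemmas smooth_on_inner = smooth_on_bilinear[OF bounded_bilinear_inner]

lemma smooth_on_powr:
  fixes f :: "real \<Rightarrow> real"
  assumes "smooth_on I f" "\<And>s. s \<in> I \<Longrightarrow> f s > 0"
  shows "smooth_on I (\<lambda>s. f s powr a)"
  using assms unfolding smooth_on_iff by (simp add: diff_upto_powr)

lemma smooth_on_divide:
  fixes f g :: "real \<Rightarrow> real"
  assumes "smooth_on I f" "smooth_on I g" "\<And>s. s \<in> I \<Longrightarrow> g s > 0"
  shows "smooth_on I (\<lambda>s. f s / g s)"
proof (rule smooth_on_cong)
  show "smooth_on I (\<lambda>s. f s * g s powr (- 1))"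
    by (intro smooth_on_mult smooth_on_powr assms)
  show "f s * g s powr (- 1) = f s / g s" if "s \<in> I" for s
    using assms(3)[OF that] by (simp add: powr_neg_one)
qed

lemma smooth_on_sqrt:
  assumes "smooth_on I f" "\<And>s. s \<in> I \<Longrightarrow> f s > 0"
  shows "smooth_on I (\<lambda>s. sqrt (f s))"
  by (rule smooth_on_cong[OF smooth_on_powr[OF assms, of "1/2"]])
    (use assms(2) in \<open>auto simp: powr_half_sqrt less_imp_le\<close>)

lemma smooth_on_norm:
  fixes v :: "real \<Rightarrow> 'b::real_inner"
  assumes "smooth_on I v" "\<And>s. s \<in> I \<Longrightarrow> v s \<noteq> 0"
  shows "smooth_on I (\<lambda>s. norm (v s))"
  unfolding norm_eq_sqrt_inner
  using assms by (intro smooth_on_sqrt smooth_on_inner) auto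

text \<open>This turns each orthonormality relation of a frame into a relation between its derivatives.\<close>

lemma inner_constant_deriv:
  fixes f g :: "real \<Rightarrow> 'b::real_inner"
  assumes "(f has_vector_derivative f') (at s within I)"
    and "(g has_vector_derivative g') (at s within I)"
    and "\<And>t. t \<in> I \<Longrightarrow> f t \<bullet> g t = c" "s \<in> I"
  shows "f s \<bullet> g' + f' \<bullet> g s = 0"
proof -
  have "((\<lambda>t. f t \<bullet> g t) has_vector_derivative f s \<bullet> g' + f' \<bullet> g s) (at s within I)"
    using bounded_bilinear.has_vector_derivative[OF bounded_bilinear_inner assms(1,2)] .
  moreover have "((\<lambda>t. f t \<bullet> g t) has_vector_derivative 0) (at s within I)"
    by (rule has_vector_derivative_transform[OF assms(4) assms(3) has_vector_derivative_const])
  ultimately show ?thesis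
    using deriv_on_eq[OF _ assms(4)] by (metis (no_types))
qed

end

section \<open>Constant angles\<close>

lemma constant_on_iff_pairwise: "f constant_on I \<longleftrightarrow> (\<forall>s\<in>I. \<forall>t\<in>I. f s = f t)"
proof
  assume "\<forall>s\<in>I. \<forall>t\<in>I. f s = f t"
  then have "\<forall>s\<in>I. f s = f (SOME t. t \<in> I)" by (meson someI)
  then show "f constant_on I" unfolding constant_on_def by blast
qed (auto simp: constant_on_def)

text \<open>
  For unit vectors the angle is the arc cosine of the inner product, and by the Cauchy--Schwarz
  inequality that product lies in the range on which the arc cosine is injective.
\<close>

lemma vec_angle_constant_iff:
  assumes u: "norm u = 1" and V: "\<And>s. s \<in> I \<Longrightarrow> norm (V s) = 1"
  shows "(\<lambda>s. vec_angle (V s) u) constant_on I \<longleftrightarrow> (\<lambda>s. V s \<bullet> u) constant_on I"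
proof -
  have angle: "vec_angle (V s) u = arccos (V s \<bullet> u)" if "s \<in> I" for s
    using u V[OF that] by (simp add: vec_angle_def)
  have "cos (vec_angle (V s) u) = V s \<bullet> u" if "s \<in> I" for s
    using Cauchy_Schwarz_ineq2[of "V s" u] u V[OF that]
    by (simp add: vec_angle_def cos_arccos_abs)
  then have "vec_angle (V s) u = vec_angle (V t) u \<longleftrightarrow> V s \<bullet> u = V t \<bullet> u"
    if "s \<in> I" "t \<in> I" for s t
    using that angle by metis
  then show ?thesis unfolding constant_on_iff_pairwise by simp
qed

section \<open>Moving frames with a Frenet system\<close>

text \<open>
  The assumptions are chosen to be invariant under the exchange of \<open>T\<close> and \<open>D\<close>. For this reason
  the frame is asked to span (\<open>complete\<close>) instead of satisfying \<open>D = T \<times> Y\<close>: the exchange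
  reverses the orientation.
\<close>

locale alternative_frame = perfect_set I for I :: "real set" +
  fixes T Y D :: "real \<Rightarrow> real^3" and p q :: "real \<Rightarrow> real"
  assumes interval: "is_interval I" and nonempty: "I \<noteq> {}"
    and TT: "s \<in> I \<Longrightarrow> T s \<bullet> T s = 1"
    and DD: "s \<in> I \<Longrightarrow> D s \<bullet> D s = 1"
    and TD: "s \<in> I \<Longrightarrow> T s \<bullet> D s = 0"
    and complete: "s \<in> I \<Longrightarrow> T s \<bullet> u = 0 \<Longrightarrow> Y s \<bullet> u = 0 \<Longrightarrow> D s \<bullet> u = 0 \<Longrightarrow> u = 0"
    and T': "s \<in> I \<Longrightarrow> (T has_vector_derivative p s *\<^sub>R Y s) (at s within I)"
    and Y': "s \<in> I \<Longrightarrow> (Y has_vector_derivative - p s *\<^sub>R T s + q s *\<^sub>R D s) (at s within I)"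
    and D': "s \<in> I \<Longrightarrow> (D has_vector_derivative - q s *\<^sub>R Y s) (at s within I)"
    and p_diff: "p differentiable_on I" and q_diff: "q differentiable_on I"
    and p_nz: "s \<in> I \<Longrightarrow> p s \<noteq> 0" and q_nz: "s \<in> I \<Longrightarrow> q s \<noteq> 0"
begin

lemma constant_if_derivative_zero:
  assumes "\<And>s. s \<in> I \<Longrightarrow> (f has_vector_derivative 0) (at s within I)"
  shows "f constant_on I"
proof -
  obtain c where "\<And>s. s \<in> I \<Longrightarrow> f s = c"
    using has_vector_derivative_zero_constant[of I f] assms interval
    unfolding is_interval_convex_1 by blast
  then show ?thesis unfolding constant_on_def by blast
qed

text \<open>
  The axis \<open>u\<close> is orthogonal to \<open>Y\<close>, so its components along \<open>T\<close> and \<open>D\<close> are both constant, and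
  \<open>Y' \<bullet> u = 0\<close> expresses \<open>p / q\<close> as their quotient.
\<close>

lemma ratio_constant_if_T_angle_constant:
  assumes "constant_angle_on I T"
  shows "(\<lambda>s. p s / q s) constant_on I"
proof -
  obtain u where u: "norm u = 1" and "(\<lambda>s. vec_angle (T s) u) constant_on I"
    using assms unfolding constant_angle_on_def by blast
  then have "(\<lambda>s. T s \<bullet> u) constant_on I"
    using TT by (subst (asm) vec_angle_constant_iff) (auto simp: norm_eq_1)
  then obtain c where c: "\<And>s. s \<in> I \<Longrightarrow> T s \<bullet> u = c"
    unfolding constant_on_def by blast
  have Yu: "Y s \<bullet> u = 0" if "s \<in> I" for s
    using inner_constant_deriv[OF T' has_vector_derivative_const[of u] c] that p_nz[of s] by auto
  have pq: "p s * c = q s * (D s \<bullet> u)" if "s \<in> I" for s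
    using inner_constant_deriv[OF Y' has_vector_derivative_const[of u] Yu] that c[of s]
    by (auto simp: inner_simps)
  have "(\<lambda>s. D s \<bullet> u) constant_on I"
  proof (rule constant_if_derivative_zero)
    fix s assume "s \<in> I"
    then show "((\<lambda>s. D s \<bullet> u) has_vector_derivative 0) (at s within I)"
      using bounded_linear.has_vector_derivative[OF bounded_linear_inner_left[of u] D', of s] Yu[of s]
      by simp
  qed
  then obtain d where d: "\<And>s. s \<in> I \<Longrightarrow> D s \<bullet> u = d"
    unfolding constant_on_def by blast
  obtain s0 where s0: "s0 \<in> I" using nonempty by blast
  \<comment> \<open>Otherwise \<open>pq\<close> makes \<open>u\<close> orthogonal to the whole frame.\<close>
  have "c \<noteq> 0"
  proof
    assume "c = 0"
    then have "D s0 \<bullet> u = 0" using pq[OF s0] q_nz[OF s0] by auto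
    then have "u = 0" using complete[OF s0] c Yu s0 \<open>c = 0\<close> by simp
    then show False using u by simp
  qed
  then have "p s / q s = d / c" if "s \<in> I" for s
    using pq[OF that] d[OF that] q_nz[OF that] by (simp add: field_simps)
  then show ?thesis unfolding constant_on_def by blast
qed

text \<open>With \<open>p = k q\<close> the derivatives of \<open>T\<close> and \<open>k D\<close> cancel, so \<open>T + k D\<close> is an axis.\<close>

lemma T_angle_constant_if_ratio_constant:
  assumes "(\<lambda>s. p s / q s) constant_on I"
  shows "constant_angle_on I T"
proof -
  obtain k where "\<And>s. s \<in> I \<Longrightarrow> p s / q s = k"
    using assms unfolding constant_on_def by blast
  then have k: "p s = k * q s" if "s \<in> I" for s
    using that q_nz[OF that] by (simp add: divide_eq_eq)
  have "(\<lambda>s. T s + k *\<^sub>R D s) constant_on I"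
  proof (rule constant_if_derivative_zero)
    fix s assume s: "s \<in> I"
    have "((\<lambda>s. T s + k *\<^sub>R D s) has_vector_derivative p s *\<^sub>R Y s + k *\<^sub>R (- q s *\<^sub>R Y s)) (at s within I)"
      by (intro has_vector_derivative_add T' D' s
          bounded_linear.has_vector_derivative[OF bounded_linear_scaleR_right])
    then show "((\<lambda>s. T s + k *\<^sub>R D s) has_vector_derivative 0) (at s within I)"
      by (simp add: k[OF s])
  qed
  then obtain w where w: "\<And>s. s \<in> I \<Longrightarrow> w = T s + k *\<^sub>R D s"
    unfolding constant_on_def by force
  have Tw: "T s \<bullet> w = 1" if "s \<in> I" for s
    using w[OF that] TT[OF that] TD[OF that] by (simp add: inner_simps)
  then have "w \<noteq> 0" using nonempty by fastforce
  moreover have "T s \<bullet> (w /\<^sub>R norm w) = 1 / norm w" if "s \<in> I" for s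
    using Tw[OF that] by (simp add: divide_inverse)
  ultimately have "norm (w /\<^sub>R norm w) = 1" "(\<lambda>s. T s \<bullet> (w /\<^sub>R norm w)) constant_on I"
    unfolding constant_on_def by auto
  moreover have "norm (T s) = 1" if "s \<in> I" for s
    using TT[OF that] by (simp add: norm_eq_1)
  ultimately show ?thesis
    unfolding constant_angle_on_def
    using vec_angle_constant_iff[of "w /\<^sub>R norm w" I T] by blast
qed

lemma T_angle_constant_iff:
  "constant_angle_on I T \<longleftrightarrow> (\<lambda>s. p s / q s) constant_on I"
  using ratio_constant_if_T_angle_constant T_angle_constant_if_ratio_constant by blast

lemma ratio_derivative:
  assumes "s \<in> I"
  shows "((\<lambda>t. p t / q t) has_vector_derivative
    (deriv_on I p s * q s - p s * deriv_on I q s) / (q s)\<^sup>2) (at s within I)"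
  using has_vector_derivative_deriv_on[OF p_diff assms] has_vector_derivative_deriv_on[OF q_diff assms]
    q_nz[OF assms]
  unfolding has_real_derivative_iff_has_vector_derivative[symmetric]
  by (auto intro!: derivative_eq_intros simp: power2_eq_square)

text \<open>
  Differentiating \<open>Y' = - p T + q D\<close> produces \<open>- (p\<^sup>2 + q\<^sup>2) Y - p' T + q' D\<close>. The zeroth-order
  term of the operator cancels the first summand, and the first-order term, whose coefficient
  \<open>q (1 / q)'\<close> is \<open>- q' / q\<close>, is the one that cancels \<open>q' D\<close>. Only a multiple of \<open>T\<close> is left.
\<close>

lemma Y_operator:
  assumes s: "s \<in> I"
  shows "deriv_on I (deriv_on I Y) s + (q s * deriv_on I (\<lambda>t. 1 / q t) s) *\<^sub>R deriv_on I Y s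
      + ((p s)\<^sup>2 + (q s)\<^sup>2) *\<^sub>R Y s = - (q s * deriv_on I (\<lambda>t. p t / q t) s) *\<^sub>R T s"
proof -
  note dp = has_vector_derivative_deriv_on[OF p_diff s]
  note dq = has_vector_derivative_deriv_on[OF q_diff s]
  have DY: "deriv_on I Y t = - p t *\<^sub>R T t + q t *\<^sub>R D t" if "t \<in> I" for t
    using deriv_on_eq[OF Y' that] that .
  have "((\<lambda>t. - p t *\<^sub>R T t + q t *\<^sub>R D t) has_vector_derivative
      ((- p s) *\<^sub>R (p s *\<^sub>R Y s) + (- deriv_on I p s) *\<^sub>R T s)
      + (q s *\<^sub>R (- q s *\<^sub>R Y s) + deriv_on I q s *\<^sub>R D s)) (at s within I)"
    by (intro has_vector_derivative_add has_vector_derivative_minus T' D' s dp dq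
        bounded_bilinear.has_vector_derivative[OF bounded_bilinear_scaleR])
  from deriv_on_eq[OF this s]
  have "deriv_on I (\<lambda>t. - p t *\<^sub>R T t + q t *\<^sub>R D t) s =
      - (p s)\<^sup>2 *\<^sub>R Y s - deriv_on I p s *\<^sub>R T s - (q s)\<^sup>2 *\<^sub>R Y s + deriv_on I q s *\<^sub>R D s"
    by (simp add: power2_eq_square algebra_simps)
  moreover have "deriv_on I (deriv_on I Y) s = deriv_on I (\<lambda>t. - p t *\<^sub>R T t + q t *\<^sub>R D t) s"
    by (rule deriv_on_cong[OF DY s])
  ultimately have DDY: "deriv_on I (deriv_on I Y) s =
      - (p s)\<^sup>2 *\<^sub>R Y s - deriv_on I p s *\<^sub>R T s - (q s)\<^sup>2 *\<^sub>R Y s + deriv_on I q s *\<^sub>R D s" by simp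
  have "((\<lambda>t. 1 / q t) has_vector_derivative - deriv_on I q s / (q s)\<^sup>2) (at s within I)"
    using dq q_nz[OF s]
    unfolding has_real_derivative_iff_has_vector_derivative[symmetric]
    by (auto intro!: derivative_eq_intros simp: power2_eq_square)
  from deriv_on_eq[OF this s]
  have Dq: "q s * deriv_on I (\<lambda>t. 1 / q t) s = - deriv_on I q s / q s"
    using q_nz[OF s] by (simp add: power2_eq_square)
  have Dpq: "q s * deriv_on I (\<lambda>t. p t / q t) s = deriv_on I p s - p s * deriv_on I q s / q s"
    using deriv_on_eq[OF ratio_derivative[OF s] s] q_nz[OF s]
    by (simp add: power2_eq_square field_simps)
  show ?thesis
    unfolding DDY Dq Dpq DY[OF s]
    using q_nz[OF s] by (simp add: algebra_simps)
qed

lemma Y_equation_iff: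
  "(\<forall>s\<in>I. deriv_on I (deriv_on I Y) s + (q s * deriv_on I (\<lambda>t. 1 / q t) s) *\<^sub>R deriv_on I Y s
      + ((p s)\<^sup>2 + (q s)\<^sup>2) *\<^sub>R Y s = 0) \<longleftrightarrow> (\<lambda>s. p s / q s) constant_on I" (is "?L \<longleftrightarrow> ?R")
proof -
  have "?L \<longleftrightarrow> (\<forall>s\<in>I. deriv_on I (\<lambda>t. p t / q t) s = 0)"
    using Y_operator q_nz TT by fastforce
  also have "\<dots> \<longleftrightarrow> ?R"
  proof
    assume zero: "\<forall>s\<in>I. deriv_on I (\<lambda>t. p t / q t) s = 0"
    show ?R
    proof (rule constant_if_derivative_zero)
      fix s assume s: "s \<in> I"
      show "((\<lambda>t. p t / q t) has_vector_derivative 0) (at s within I)"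
        using ratio_derivative[OF s] deriv_on_eq[OF ratio_derivative[OF s] s] zero s by metis
    qed
  next
    assume ?R
    then obtain k where k: "\<And>s. s \<in> I \<Longrightarrow> p s / q s = k" unfolding constant_on_def by blast
    have "deriv_on I (\<lambda>t. p t / q t) s = 0" if "s \<in> I" for s
      by (rule deriv_on_eq[OF has_vector_derivative_transform[OF that k has_vector_derivative_const] that])
    then show "\<forall>s\<in>I. deriv_on I (\<lambda>t. p t / q t) s = 0" by blast
  qed
  finally show ?thesis .
qed

text \<open>
  Read backwards, \<open>D' = - q Y\<close> is the first equation of the system and \<open>T' = p Y\<close> the last, which
  forces the first coefficient to be \<open>- q\<close> and the second \<open>- p\<close>; the middle equation is symmetric.
\<close>

lemma reversed_frame: "alternative_frame I D Y T (\<lambda>s. - q s) (\<lambda>s. - p s)"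
proof unfold_locales
  fix s assume s: "s \<in> I"
  show "D s \<bullet> T s = 0" using TD[OF s] by (simp add: inner_commute)
  show "(Y has_vector_derivative - (- q s) *\<^sub>R D s + (- p s) *\<^sub>R T s) (at s within I)"
    using Y'[OF s] by (simp add: add.commute)
  show "(D has_vector_derivative (- q s) *\<^sub>R Y s) (at s within I)"
    using D'[OF s] by simp
  show "(T has_vector_derivative - (- p s) *\<^sub>R Y s) (at s within I)"
    using T'[OF s] by simp
qed (use interval nonempty TT DD complete p_nz q_nz p_diff q_diff in
  \<open>auto simp: differentiable_on_minus\<close>)

lemma D_angle_constant_iff:
  "constant_angle_on I D \<longleftrightarrow> (\<lambda>s. p s / q s) constant_on I"
proof -
  interpret rev: alternative_frame I D Y T "\<lambda>s. - q s" "\<lambda>s. - p s" by (rule reversed_frame)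
  have "constant_angle_on I D \<longleftrightarrow> (\<lambda>s. q s / p s) constant_on I"
    using rev.T_angle_constant_iff by simp
  also have "\<dots> \<longleftrightarrow> (\<lambda>s. p s / q s) constant_on I"
  proof -
    have "q s / p s = q t / p t \<longleftrightarrow> p s / q s = p t / q t" if "s \<in> I" "t \<in> I" for s t
      using that p_nz q_nz by (auto simp: frac_eq_eq mult.commute)
    then show ?thesis unfolding constant_on_iff_pairwise by simp
  qed
  finally show ?thesis .
qed

end

section \<open>The alternative frame of a Myller configuration\<close>

lemma bounded_bilinear_cross3: "bounded_bilinear cross3"
  using bilinear_cross bilinear_conv_bounded_bilinear by blast

text \<open>
  Write \<open>e = a \<times> b\<close>. The vector \<open>e \<times> (v \<times> e)\<close> is the component of \<open>v\<close> orthogonal to \<open>e\<close>; expanding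
  the inner cross product \<open>v \<times> (a \<times> b)\<close> first gives its coordinates along \<open>a\<close> and \<open>b\<close>.
\<close>

lemma orthonormal_expansion:
  fixes a b v :: "real^3"
  assumes "a \<bullet> a = 1" "b \<bullet> b = 1" "a \<bullet> b = 0"
  shows "v = (v \<bullet> a) *\<^sub>R a + (v \<bullet> b) *\<^sub>R b + (v \<bullet> cross3 a b) *\<^sub>R cross3 a b"
proof -
  let ?e = "cross3 a b"
  have e: "?e \<bullet> ?e = 1"
    using norm_cross_dot[of a b] assms by (simp add: power2_norm_eq_inner power_mult_distrib)
  have ea: "cross3 ?e a = b" and eb: "cross3 ?e b = - a"
    using Lagrange[of a a b] Lagrange[of b a b] assms
    by (simp_all add: cross_skew[of ?e] inner_commute)
  have "cross3 v ?e = (v \<bullet> b) *\<^sub>R a - (v \<bullet> a) *\<^sub>R b"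
    by (rule Lagrange)
  moreover have "cross3 ?e (cross3 v ?e) = v - (v \<bullet> ?e) *\<^sub>R ?e"
    using Lagrange[of ?e v ?e] e by (simp add: inner_commute)
  ultimately have "v - (v \<bullet> ?e) *\<^sub>R ?e = (v \<bullet> a) *\<^sub>R a + (v \<bullet> b) *\<^sub>R b"
    by (simp add: Cross3.right_diff_distrib cross_mult_right ea eb add.commute)
  then show ?thesis by (simp add: diff_eq_eq)
qed

locale myller =
  fixes I :: "real set" and r \<xi> :: "real \<Rightarrow> real^3" and \<pi> :: "real \<Rightarrow> (real^3) set"
  assumes config: "myller_configuration I r \<xi> \<pi>"
begin

lemma interval: "is_interval I" and nonempty: "I \<noteq> {}"
  using config unfolding myller_configuration_def by auto

sublocale perfect_set I
proof
  fix s assume "s \<in> I"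
  moreover have "I \<noteq> {x}" for x
    using config unfolding myller_configuration_def by auto
  ultimately show "at s within I \<noteq> bot"
    using connected_imp_perfect interval is_interval_connected trivial_limit_within by blast
qed

abbreviation "e2 \<equiv> \<xi>2 I \<xi>"
abbreviation "e3 \<equiv> \<xi>3 I \<xi>"
abbreviation "k1 \<equiv> K1 I \<xi>"
abbreviation "k2 \<equiv> K2 I \<xi>"
abbreviation "Y \<equiv> AF_Y I \<xi>"
abbreviation "D \<equiv> AF_D I \<xi>"
abbreviation "p \<equiv> AF_p I \<xi>"
abbreviation "q \<equiv> AF_q I \<xi>"

lemma smooth_\<xi>: "smooth_on I \<xi>"
  using config unfolding myller_configuration_def by blast

lemma k1_pos: "s \<in> I \<Longrightarrow> k1 s > 0"
  using config unfolding myller_configuration_def by blast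

lemma p_pos: "s \<in> I \<Longrightarrow> p s > 0"
  using k1_pos[of s] by (simp add: AF_p_def add_pos_nonneg)

lemma smooth_k1: "smooth_on I k1"
proof -
  have "deriv_on I \<xi> s \<noteq> 0" if "s \<in> I" for s
    using k1_pos[OF that] by (auto simp: K1_def)
  then have "smooth_on I (\<lambda>s. norm (deriv_on I \<xi> s))"
    by (intro smooth_on_norm smooth_on_deriv_on smooth_\<xi>)
  then show ?thesis by (simp add: K1_def[abs_def])
qed

lemma smooth_e2: "smooth_on I e2"
proof -
  have "smooth_on I (\<lambda>s. (1 / k1 s) *\<^sub>R deriv_on I \<xi> s)"
    by (intro smooth_on_scaleR smooth_on_divide smooth_on_const smooth_k1 k1_pos
        smooth_on_deriv_on smooth_\<xi>)
  then show ?thesis by (simp add: \<xi>2_def[abs_def] \<xi>1_def)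
qed

lemma smooth_e3: "smooth_on I e3"
proof -
  have "smooth_on I (\<lambda>s. cross3 (\<xi> s) (e2 s))"
    by (intro smooth_on_bilinear[OF bounded_bilinear_cross3] smooth_\<xi> smooth_e2)
  then show ?thesis by (simp add: \<xi>3_def[abs_def] \<xi>1_def)
qed

lemma smooth_k2: "smooth_on I k2"
proof -
  have "smooth_on I (\<lambda>s. deriv_on I e2 s \<bullet> e3 s)"
    by (intro smooth_on_inner smooth_on_deriv_on smooth_e2 smooth_e3)
  then show ?thesis by (simp add: K2_def[abs_def])
qed

lemma k_sq_pos: "s \<in> I \<Longrightarrow> k1 s * k1 s + k2 s * k2 s > 0"
  using k1_pos[of s] by (simp add: add_pos_nonneg)

lemma smooth_p: "smooth_on I p"
proof -
  have "smooth_on I (\<lambda>s. sqrt (k1 s * k1 s + k2 s * k2 s))"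
    by (intro smooth_on_sqrt smooth_on_add smooth_on_mult smooth_k1 smooth_k2 k_sq_pos)
  then show ?thesis by (simp add: AF_p_def[abs_def] power2_eq_square)
qed

lemma smooth_q: "smooth_on I q"
proof -
  have "smooth_on I (\<lambda>s. (k1 s * k1 s) / (k1 s * k1 s + k2 s * k2 s)
      * deriv_on I (\<lambda>t. k2 t / k1 t) s)"
    by (intro smooth_on_mult smooth_on_divide smooth_on_add smooth_on_deriv_on
        smooth_k1 smooth_k2 k_sq_pos k1_pos)
  then show ?thesis by (simp add: AF_q_def[abs_def] power2_eq_square)
qed

lemma \<xi>_deriv: "s \<in> I \<Longrightarrow> (\<xi> has_vector_derivative k1 s *\<^sub>R e2 s) (at s within I)"
  using smooth_on_has_derivative[OF smooth_\<xi>] k1_pos by (fastforce simp: \<xi>2_def \<xi>1_def)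

lemma e1_e1: "s \<in> I \<Longrightarrow> \<xi> s \<bullet> \<xi> s = 1"
  using config unfolding myller_configuration_def by (simp add: norm_eq_1)

lemma e2_e2: "s \<in> I \<Longrightarrow> e2 s \<bullet> e2 s = 1"
  using k1_pos[of s] by (simp add: \<xi>2_def \<xi>1_def K1_def dot_square_norm power2_eq_square)

lemma e1_e2: "s \<in> I \<Longrightarrow> \<xi> s \<bullet> e2 s = 0"
  using inner_constant_deriv[OF \<xi>_deriv \<xi>_deriv e1_e1, of s] k1_pos[of s]
  by (simp add: inner_commute)

lemma cross_frame:
  assumes "s \<in> I"
  shows "cross3 (\<xi> s) (e2 s) = e3 s" "cross3 (e2 s) (e3 s) = \<xi> s" "cross3 (e3 s) (\<xi> s) = e2 s"
  using Lagrange[of "e2 s" "\<xi> s" "e2 s"] Lagrange[of "\<xi> s" "\<xi> s" "e2 s"]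
    e1_e1[OF assms] e2_e2[OF assms] e1_e2[OF assms]
  by (simp_all add: \<xi>3_def \<xi>1_def inner_commute cross_skew[of "cross3 (\<xi> s) (e2 s)"])

lemma e3_e3: "s \<in> I \<Longrightarrow> e3 s \<bullet> e3 s = 1"
  using norm_cross_dot[of "\<xi> s" "e2 s"] e1_e1[of s] e2_e2[of s] e1_e2[of s] cross_frame(1)[of s]
  by (simp add: power2_norm_eq_inner power_mult_distrib)

lemma e1_e3: "\<xi> s \<bullet> e3 s = 0" and e2_e3: "e2 s \<bullet> e3 s = 0"
  by (simp_all add: \<xi>3_def \<xi>1_def dot_cross_self)

lemma e2_deriv:
  assumes s: "s \<in> I"
  shows "(e2 has_vector_derivative - k1 s *\<^sub>R \<xi> s + k2 s *\<^sub>R e3 s) (at s within I)"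
proof -
  let ?d = "deriv_on I e2 s"
  have d: "(e2 has_vector_derivative ?d) (at s within I)"
    using smooth_on_has_derivative[OF smooth_e2 s] .
  have "?d \<bullet> e2 s = 0"
    using inner_constant_deriv[OF d d e2_e2 s] by (simp add: inner_commute)
  moreover have "?d \<bullet> \<xi> s = - k1 s"
    using inner_constant_deriv[OF \<xi>_deriv[OF s] d e1_e2 s] e2_e2[OF s] by (simp add: inner_commute)
  moreover have "?d \<bullet> e3 s = k2 s"
    by (simp add: K2_def)
  ultimately have "?d = - k1 s *\<^sub>R \<xi> s + k2 s *\<^sub>R e3 s"
    using orthonormal_expansion[OF e1_e1[OF s] e2_e2[OF s] e1_e2[OF s], of ?d]
    by (simp add: cross_frame(1)[OF s])
  with d show ?thesis by simp
qed

lemma norm_e2_deriv: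
  assumes s: "s \<in> I"
  shows "norm (deriv_on I e2 s) = p s"
  unfolding deriv_on_eq[OF e2_deriv[OF s] s] norm_eq_sqrt_inner AF_p_def
  using e1_e1[OF s] e3_e3[OF s] e1_e3[of s]
  by (simp add: inner_simps inner_commute power2_eq_square)

lemma e2_deriv_Y: "s \<in> I \<Longrightarrow> (e2 has_vector_derivative p s *\<^sub>R Y s) (at s within I)"
  using smooth_on_has_derivative[OF smooth_e2, of s] p_pos[of s]
  by (simp add: AF_Y_def norm_e2_deriv)

lemma Y_eq: "s \<in> I \<Longrightarrow> Y s = (1 / p s) *\<^sub>R (- k1 s *\<^sub>R \<xi> s + k2 s *\<^sub>R e3 s)"
  unfolding AF_Y_def norm_e2_deriv by (simp only: deriv_on_eq[OF e2_deriv])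

lemma Y_Y: "s \<in> I \<Longrightarrow> Y s \<bullet> Y s = 1"
  using p_pos[of s] norm_e2_deriv[of s]
  by (simp add: AF_Y_def power2_norm_eq_inner[symmetric] power2_eq_square)

lemma e2_Y: "s \<in> I \<Longrightarrow> e2 s \<bullet> Y s = 0"
  using e1_e2[of s] e2_e3[of s] by (simp add: Y_eq inner_simps inner_commute)

lemma D_eq: "s \<in> I \<Longrightarrow> D s = (k2 s / p s) *\<^sub>R \<xi> s + (k1 s / p s) *\<^sub>R e3 s"
  using cross_frame[of s]
  by (simp add: AF_D_def Y_eq cross_add_right cross_mult_right cross_skew[of "e2 s" "\<xi> s"]
      Cross3.right_diff_distrib algebra_simps)

lemma D_D: "s \<in> I \<Longrightarrow> D s \<bullet> D s = 1"
  using norm_cross_dot[of "e2 s" "Y s"] e2_e2[of s] Y_Y[of s] e2_Y[of s]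
  by (simp add: AF_D_def power2_norm_eq_inner power_mult_distrib)

lemma e2_D: "e2 s \<bullet> D s = 0" and Y_D: "Y s \<bullet> D s = 0"
  by (simp_all add: AF_D_def dot_cross_self)

lemma smooth_Y: "smooth_on I Y"
proof -
  have "smooth_on I (\<lambda>s. (1 / p s) *\<^sub>R deriv_on I e2 s)"
    by (intro smooth_on_scaleR smooth_on_divide smooth_on_const smooth_p p_pos
        smooth_on_deriv_on smooth_e2)
  then show ?thesis
    by (rule smooth_on_cong) (simp add: AF_Y_def norm_e2_deriv)
qed

lemma smooth_D: "smooth_on I D"
  unfolding AF_D_def[abs_def]
  by (intro smooth_on_bilinear[OF bounded_bilinear_cross3] smooth_Y smooth_e2)

lemma e3_deriv:
  assumes s: "s \<in> I"
  shows "(e3 has_vector_derivative - k2 s *\<^sub>R e2 s) (at s within I)"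
proof -
  have "((\<lambda>s. cross3 (\<xi> s) (e2 s)) has_vector_derivative
      cross3 (\<xi> s) (- k1 s *\<^sub>R \<xi> s + k2 s *\<^sub>R e3 s) + cross3 (k1 s *\<^sub>R e2 s) (e2 s)) (at s within I)"
    by (intro bounded_bilinear.has_vector_derivative[OF bounded_bilinear_cross3] \<xi>_deriv e2_deriv s)
  moreover have "(\<lambda>s. cross3 (\<xi> s) (e2 s)) = e3"
    by (simp add: \<xi>3_def[abs_def] \<xi>1_def)
  moreover have "cross3 (\<xi> s) (e3 s) = - e2 s"
    using cross_frame(3)[OF s] cross_skew[of "\<xi> s" "e3 s"] by simp
  ultimately show ?thesis
    by (simp add: cross_add_right Cross3.right_diff_distrib cross_mult_right cross_mult_left)
qed

text \<open>
  In the frame \<open>\<xi>\<^sub>1, \<xi>\<^sub>2, \<xi>\<^sub>3\<close> one has \<open>D = b \<xi>\<^sub>1 + a \<xi>\<^sub>3\<close> and \<open>Y = - a \<xi>\<^sub>1 + b \<xi>\<^sub>3\<close> with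
  \<open>a = K\<^sub>1 / p\<close> and \<open>b = K\<^sub>2 / p\<close>. The \<open>\<xi>\<^sub>2\<close>-components of \<open>D'\<close> cancel, and
  \<open>D' \<bullet> Y = - (a b' - b a') = - a\<^sup>2 (b / a)'\<close>, where \<open>b / a = K\<^sub>2 / K\<^sub>1\<close>: this is \<open>- q\<close>.
\<close>

lemma D_deriv_inner_Y:
  assumes s: "s \<in> I"
  shows "deriv_on I D s \<bullet> Y s = - q s"
proof -
  define a where "a t = k1 t / p t" for t
  define b where "b t = k2 t / p t" for t
  have "smooth_on I a" "smooth_on I b"
    unfolding a_def b_def by (intro smooth_on_divide smooth_k1 smooth_k2 smooth_p p_pos; assumption)+
  then have a': "(a has_vector_derivative deriv_on I a s) (at s within I)"
    and b': "(b has_vector_derivative deriv_on I b s) (at s within I)"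
    using smooth_on_has_derivative s by blast+
  have a_pos: "a t > 0" if "t \<in> I" for t
    using k1_pos[OF that] p_pos[OF that] by (simp add: a_def)
  have "((\<lambda>t. b t *\<^sub>R \<xi> t + a t *\<^sub>R e3 t) has_vector_derivative
      (b s *\<^sub>R (k1 s *\<^sub>R e2 s) + deriv_on I b s *\<^sub>R \<xi> s)
      + (a s *\<^sub>R (- k2 s *\<^sub>R e2 s) + deriv_on I a s *\<^sub>R e3 s)) (at s within I)"
    by (intro has_vector_derivative_add s a' b' \<xi>_deriv e3_deriv
        bounded_bilinear.has_vector_derivative[OF bounded_bilinear_scaleR])
  then have "(D has_vector_derivative deriv_on I b s *\<^sub>R \<xi> s + deriv_on I a s *\<^sub>R e3 s) (at s within I)"
    using s by (intro has_vector_derivative_transform[of s I D "\<lambda>t. b t *\<^sub>R \<xi> t + a t *\<^sub>R e3 t"])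
      (auto simp: D_eq a_def b_def mult.commute)
  then have "deriv_on I D s = deriv_on I b s *\<^sub>R \<xi> s + deriv_on I a s *\<^sub>R e3 s"
    using deriv_on_eq s by blast
  moreover have "Y s = - a s *\<^sub>R \<xi> s + b s *\<^sub>R e3 s"
    using s by (simp add: Y_eq a_def b_def scaleR_right_diff_distrib scaleR_right_distrib)
  ultimately have DY: "deriv_on I D s \<bullet> Y s = - (a s * deriv_on I b s - b s * deriv_on I a s)"
    using e1_e1[OF s] e3_e3[OF s] e1_e3[of s] by (simp add: inner_simps inner_commute)
  have "((\<lambda>t. b t / a t) has_vector_derivative
      (a s * deriv_on I b s - b s * deriv_on I a s) / (a s)\<^sup>2) (at s within I)"
    using a' b' a_pos[OF s] unfolding has_real_derivative_iff_has_vector_derivative[symmetric]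
    by (auto intro!: derivative_eq_intros simp: power2_eq_square mult.commute)
  moreover have "b t / a t = k2 t / k1 t" if "t \<in> I" for t
    using p_pos[OF that] by (simp add: a_def b_def)
  then have "deriv_on I (\<lambda>t. b t / a t) s = deriv_on I (\<lambda>t. k2 t / k1 t) s"
    using s by (rule deriv_on_cong)
  ultimately have "deriv_on I (\<lambda>t. k2 t / k1 t) s
      = (a s * deriv_on I b s - b s * deriv_on I a s) / (a s)\<^sup>2"
    by (simp only: deriv_on_eq[OF _ s])
  moreover have "(a s)\<^sup>2 = (k1 s)\<^sup>2 / ((k1 s)\<^sup>2 + (k2 s)\<^sup>2)"
    by (simp add: a_def AF_p_def power_divide)
  ultimately have "q s = a s * deriv_on I b s - b s * deriv_on I a s"
    using k1_pos[OF s] a_pos[OF s] by (simp add: AF_q_def)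
  with DY show ?thesis by simp
qed

lemma AF_expansion:
  assumes "s \<in> I"
  shows "v = (v \<bullet> e2 s) *\<^sub>R e2 s + (v \<bullet> Y s) *\<^sub>R Y s + (v \<bullet> D s) *\<^sub>R D s"
  using orthonormal_expansion[OF e2_e2[OF assms] Y_Y[OF assms] e2_Y[OF assms]]
  by (simp add: AF_D_def)

lemma D_deriv:
  assumes s: "s \<in> I"
  shows "(D has_vector_derivative - q s *\<^sub>R Y s) (at s within I)"
proof -
  let ?d = "deriv_on I D s"
  have d: "(D has_vector_derivative ?d) (at s within I)"
    using smooth_on_has_derivative[OF smooth_D s] .
  have "?d \<bullet> D s = 0"
    using inner_constant_deriv[OF d d D_D s] by (simp add: inner_commute)
  moreover have "?d \<bullet> e2 s = 0"
    using inner_constant_deriv[OF e2_deriv_Y[OF s] d e2_D s] Y_D[of s] by (simp add: inner_commute)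
  ultimately have "?d = - q s *\<^sub>R Y s"
    using AF_expansion[OF s, of ?d] D_deriv_inner_Y[OF s] by simp
  with d show ?thesis by simp
qed

lemma Y_deriv:
  assumes s: "s \<in> I"
  shows "(Y has_vector_derivative - p s *\<^sub>R e2 s + q s *\<^sub>R D s) (at s within I)"
proof -
  let ?d = "deriv_on I Y s"
  have d: "(Y has_vector_derivative ?d) (at s within I)"
    using smooth_on_has_derivative[OF smooth_Y s] .
  have "?d \<bullet> Y s = 0"
    using inner_constant_deriv[OF d d Y_Y s] by (simp add: inner_commute)
  moreover have "?d \<bullet> e2 s = - p s"
    using inner_constant_deriv[OF e2_deriv_Y[OF s] d e2_Y s] Y_Y[OF s] by (simp add: inner_commute)
  moreover have "?d \<bullet> D s = q s"
    using inner_constant_deriv[OF d D_deriv[OF s] Y_D s] Y_Y[OF s] by simp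
  ultimately have "?d = - p s *\<^sub>R e2 s + q s *\<^sub>R D s"
    using AF_expansion[OF s, of ?d] by simp
  with d show ?thesis by simp
qed

lemma alternative_frame:
  assumes "\<And>s. s \<in> I \<Longrightarrow> q s \<noteq> 0"
  shows "alternative_frame I e2 Y D p q"
proof unfold_locales
  fix s u assume "s \<in> I" "e2 s \<bullet> u = 0" "Y s \<bullet> u = 0" "D s \<bullet> u = 0"
  then show "u = 0" using AF_expansion[of s u] by (simp add: inner_commute)
next
  show "p s \<noteq> 0" if "s \<in> I" for s
    using p_pos[OF that] by simp
qed (use assms interval nonempty e2_e2 D_D e2_D e2_deriv_Y Y_deriv D_deriv
    smooth_on_differentiable[OF smooth_p] smooth_on_differentiable[OF smooth_q] in auto)

end

theorem corollary16:
  fixes I :: "real set" and r \<xi> :: "real \<Rightarrow> real^3" and \<pi> :: "real \<Rightarrow> (real^3) set"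
  defines "Y \<equiv> AF_Y I \<xi>" and "p \<equiv> AF_p I \<xi>" and "q \<equiv> AF_q I \<xi>"
  assumes "myller_configuration I r \<xi> \<pi>"
    and "\<forall>s\<in>I. p s \<noteq> 0 \<and> q s \<noteq> 0"
  shows "(slant_helix I \<xi> \<longleftrightarrow> darboux_helix I \<xi>) \<and>
    (slant_helix I \<xi> \<longleftrightarrow>
      (\<forall>s\<in>I. deriv_on I (deriv_on I Y) s
          + (q s * deriv_on I (\<lambda>t. 1 / q t) s) *\<^sub>R deriv_on I Y s
          + ((p s)\<^sup>2 + (q s)\<^sup>2) *\<^sub>R Y s = 0))"
proof -
  interpret myller I r \<xi> \<pi> by unfold_locales (rule assms)
  interpret frame: alternative_frame I "\<xi>2 I \<xi>" Y "AF_D I \<xi>" p q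
    unfolding Y_def p_def q_def by (rule alternative_frame) (use assms in auto)
  show ?thesis
    unfolding slant_helix_def darboux_helix_def frame.Y_equation_iff
      frame.T_angle_constant_iff frame.D_angle_constant_iff by simp
qed

end
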